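(* Let $(E,d)$ be a complete metric space satisfying the median inequality, and let $G\le \mathrm{Isom}\,E$ be a group of isometries of $E$ and $H\unlhd G$ a normal subgroup such that $G/H$ is solvable and finite. If $H$ is fixating (acting on $E$), then $G$ is fixating. In particular, a group of isometries of $E$ is fixating provided that it contains a fixating subgroup of index $2$.
   Context: A metric space $(X,d)$ satisfies the median inequality if for all $x,y\in X$ there exists $m\in X$ such that for all $z\in X$: $d(z,m)^2\le\frac12\big(d(z,x)^2+d(z,y)^2\big)-\frac14 d(x,y)^2$. An isometry of a metric space is a distance-preserving bijection of the space onto itself; $\mathrm{Isom}\,E$ is the group of isometries of $E$. For a bijection $g$ of a set $X$, $\mathrm{Fix}\,g=\{x\in X: g(x)=x\}$. A group $H$ of bijections of $X$ is a GAF if $\mathrm{Fix}\,g\neq\emptyset$ for every $g\in H$; it is a GAG if $\bigcap_{g\in H}\mathrm{Fix}\,g\ne\emptyset$. A group $G$ of bijections of $X$ is fixating if every subgroup of $G$ that is a GAF is a GAG. *)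

theory Defs
  imports "HOL-Analysis.Abstract_Metric_Spaces" "HOL-Algebra.Bij" "HOL-Algebra.Solvable_Groups"
begin

definition median_inequality :: "'a set \<Rightarrow> ('a \<Rightarrow> 'a \<Rightarrow> real) \<Rightarrow> bool"
  where "median_inequality X d \<longleftrightarrow>
    (\<forall>x\<in>X. \<forall>y\<in>X. \<exists>m\<in>X. \<forall>z\<in>X.
      (d z m)\<^sup>2 \<le> 1/2 * ((d z x)\<^sup>2 + (d z y)\<^sup>2) - 1/4 * (d x y)\<^sup>2)"

(* Elements of BijGroup X are extensional functions (undefined outside X), so that
   each bijection of X is represented by exactly one function. *)

definition Isom :: "'a set \<Rightarrow> ('a \<Rightarrow> 'a \<Rightarrow> real) \<Rightarrow> ('a \<Rightarrow> 'a) set"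
  where "Isom X d = {f \<in> Bij X. \<forall>x\<in>X. \<forall>y\<in>X. d (f x) (f y) = d x y}"

definition IsomGroup :: "'a set \<Rightarrow> ('a \<Rightarrow> 'a \<Rightarrow> real) \<Rightarrow> ('a \<Rightarrow> 'a) monoid"
  where "IsomGroup X d = BijGroup X \<lparr>carrier := Isom X d\<rparr>"

definition Fix :: "'a set \<Rightarrow> ('a \<Rightarrow> 'a) \<Rightarrow> 'a set"
  where "Fix X g = {x \<in> X. g x = x}"

(* The next three notions are meant for (carriers of) subgroups of BijGroup X; as such a
   carrier is nonempty, the intersection in GAG is a subset of X. *)

definition GAF :: "'a set \<Rightarrow> ('a \<Rightarrow> 'a) set \<Rightarrow> bool"
  where "GAF X H \<longleftrightarrow> (\<forall>g\<in>H. Fix X g \<noteq> {})"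

definition GAG :: "'a set \<Rightarrow> ('a \<Rightarrow> 'a) set \<Rightarrow> bool"
  where "GAG X H \<longleftrightarrow> (\<Inter>g\<in>H. Fix X g) \<noteq> {}"

definition fixating :: "'a set \<Rightarrow> ('a \<Rightarrow> 'a) set \<Rightarrow> bool"
  where "fixating X G \<longleftrightarrow>
    (\<forall>K. subgroup K (BijGroup X \<lparr>carrier := G\<rparr>) \<longrightarrow> GAF X K \<longrightarrow> GAG X K)"

lemma subgroup_Isom: "subgroup (Isom X d) (BijGroup X)"
proof (rule group.subgroupI[OF group_BijGroup])
  show "Isom X d \<subseteq> carrier (BijGroup X)"
    by (auto simp: Isom_def BijGroup_def)
  have "(\<lambda>x\<in>X. x) \<in> Isom X d"
    by (simp add: Isom_def id_Bij)
  then show "Isom X d \<noteq> {}"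
    by blast
next
  fix f assume f: "f \<in> Isom X d"
  then have fB: "f \<in> Bij X" and fX: "f ` X = X"
    by (auto simp: Isom_def Bij_def bij_betw_def)
  have "d (inv_into X f x) (inv_into X f y) = d x y" if "x \<in> X" "y \<in> X" for x y
  proof -
    have "d (f (inv_into X f x)) (f (inv_into X f y)) = d (inv_into X f x) (inv_into X f y)"
      using f that Bij_inv_into_mem[OF fB] by (auto simp: Isom_def)
    then show ?thesis
      using that fX by (simp add: f_inv_into_f)
  qed
  then show "inv\<^bsub>BijGroup X\<^esub> f \<in> Isom X d"
    using fB by (simp add: inv_BijGroup Isom_def restrict_inv_into_Bij)
next
  fix f g assume "f \<in> Isom X d" "g \<in> Isom X d"
  moreover from this have "g x \<in> X" if "x \<in> X" for x
    using that Bij_imp_funcset[of g X] by (auto simp: Isom_def)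
  ultimately show "f \<otimes>\<^bsub>BijGroup X\<^esub> g \<in> Isom X d"
    by (auto simp: Isom_def BijGroup_def compose_Bij compose_eq)
qed

lemma group_IsomGroup: "group (IsomGroup X d)"
  unfolding IsomGroup_def
  by (rule group.subgroup_imp_group[OF group_BijGroup subgroup_Isom])

end

theory Submission
  imports Defs
begin

text \<open>The theorem comes down to the Bruhat-Tits fixed point theorem: in a complete metric space
  satisfying the median inequality, a group of isometries with a bounded orbit fixes a point.

  Let \<open>K \<le> G\<close> be a GAF. Then \<open>K \<inter> H\<close> is a GAF contained in \<open>H\<close>, so, \<open>H\<close> being fixating, all of
  \<open>K \<inter> H\<close> fixes some point \<open>x\<close>. In both parts \<open>H\<close> has finite index in \<open>G\<close>, so \<open>K \<inter> H\<close>
  has finite index in \<open>K\<close>; hence the stabiliser of \<open>x\<close> in \<open>K\<close> has finite index, and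
  the orbit of \<open>x\<close> under \<open>K\<close> is finite
  (\<open>finite_orbit\<close>). A finite orbit is bounded, so \<open>K\<close> fixes a point.

  The fixed point is the circumcentre of the orbit \<open>B\<close>: the centre of the smallest closed ball
  containing \<open>B\<close>. If two balls of squared radius \<open>R\<close> contain \<open>B\<close>, then by the median inequality a
  ball around the median of their centres contains \<open>B\<close> too, and its squared radius is smaller
  than \<open>R\<close> by a quarter of the squared distance of the two centres (\<open>centers_close\<close>).
  So centres of almost smallest balls are close together: by completeness they converge to the
  centre of a smallest ball, and this centre is unique (\<open>ex1_circumcenter\<close>).
  An isometry preserving \<open>B\<close> maps circumcentres to
  circumcentres, and so fixes the only one (\<open>GAG_if_bounded_orbit\<close>).\<close>

section \<open>Circumcentres of bounded sets\<close>

text \<open>The radii are squared because the median inequality is linear in squared distances.\<close>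

definition sq_radius_bounds :: "'a set \<Rightarrow> ('a \<Rightarrow> 'a \<Rightarrow> real) \<Rightarrow> 'a set \<Rightarrow> real set"
  where "sq_radius_bounds E d B = {R. \<exists>z\<in>E. \<forall>b\<in>B. (d z b)\<^sup>2 \<le> R}"

definition sq_circumradius :: "'a set \<Rightarrow> ('a \<Rightarrow> 'a \<Rightarrow> real) \<Rightarrow> 'a set \<Rightarrow> real"
  where "sq_circumradius E d B = Inf (sq_radius_bounds E d B)"

lemma bdd_below_sq_radius_bounds:
  assumes "B \<noteq> {}"
  shows "bdd_below (sq_radius_bounds E d B)"
proof (rule bdd_belowI)
  fix R assume "R \<in> sq_radius_bounds E d B"
  with assms obtain z b where "(d z b)\<^sup>2 \<le> R"
    by (auto simp: sq_radius_bounds_def)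
  then show "0 \<le> R"
    by (rule order_trans[OF zero_le_power2])
qed

lemma sq_circumradius_le:
  assumes "B \<noteq> {}" "z \<in> E" "\<And>b. b \<in> B \<Longrightarrow> (d z b)\<^sup>2 \<le> R"
  shows "sq_circumradius E d B \<le> R"
  unfolding sq_circumradius_def
  using assms by (intro cInf_lower bdd_below_sq_radius_bounds) (auto simp: sq_radius_bounds_def)

text \<open>By the median inequality, the ball around the median of \<open>x\<close> and \<open>y\<close> with squared
  radius \<open>R - d(x, y)\<^sup>2 / 4\<close> contains \<open>B\<close>, so this number is at least the squared circumradius.\<close>

lemma (in Metric_space) centers_close:
  assumes med: "median_inequality M d" and B: "B \<noteq> {}" "B \<subseteq> M" and xy: "x \<in> M" "y \<in> M"
    and x: "\<And>b. b \<in> B \<Longrightarrow> (d x b)\<^sup>2 \<le> R" and y: "\<And>b. b \<in> B \<Longrightarrow> (d y b)\<^sup>2 \<le> R"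
  shows "(d x y)\<^sup>2 \<le> 4 * (R - sq_circumradius M d B)"
proof -
  obtain m where m: "m \<in> M"
    "\<And>z. z \<in> M \<Longrightarrow> (d z m)\<^sup>2 \<le> 1/2 * ((d z x)\<^sup>2 + (d z y)\<^sup>2) - 1/4 * (d x y)\<^sup>2"
    using med xy unfolding median_inequality_def by meson
  have "sq_circumradius M d B \<le> R - 1/4 * (d x y)\<^sup>2"
  proof (rule sq_circumradius_le[OF B(1) m(1)])
    fix b assume b: "b \<in> B"
    then have "(d b m)\<^sup>2 \<le> 1/2 * ((d b x)\<^sup>2 + (d b y)\<^sup>2) - 1/4 * (d x y)\<^sup>2"
      using m(2) B(2) by blast
    then show "(d m b)\<^sup>2 \<le> R - 1/4 * (d x y)\<^sup>2"
      using x[OF b] y[OF b] unfolding commute[of _ b] by argo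
  qed
  then show ?thesis by simp
qed

text \<open>A smallest ball is obtained as a limit, without compactness: the centres of balls whose
  squared radii tend to the squared circumradius form a Cauchy sequence, by the estimate above.
  Applied to two smallest balls, the same estimate gives uniqueness.\<close>

lemma (in Metric_space) ex1_circumcenter:
  assumes complete: mcomplete and med: "median_inequality M d"
    and B: "B \<noteq> {}" "mbounded B"
  shows "\<exists>!c. c \<in> M \<and> (\<forall>b\<in>B. (d c b)\<^sup>2 \<le> sq_circumradius M d B)"
proof (rule ex_ex1I)
  let ?r = "sq_circumradius M d B"
  have BM: "B \<subseteq> M"
    using B(2) by (rule mbounded_subset_mspace)
  obtain z C where z: "z \<in> M" "\<And>b. b \<in> B \<Longrightarrow> d z b \<le> C"
    using B by (auto simp: mbounded_def mcball_def subset_iff)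
  then have "(d z b)\<^sup>2 \<le> C\<^sup>2" if "b \<in> B" for b
    using that by (intro power_mono) auto
  then have ne: "sq_radius_bounds M d B \<noteq> {}"
    using z(1) by (auto simp: sq_radius_bounds_def)
  have approx: "\<exists>z\<in>M. \<forall>b\<in>B. (d z b)\<^sup>2 \<le> ?r + e" if e: "e > 0" for e
  proof -
    obtain R where R: "R \<in> sq_radius_bounds M d B" "R < ?r + e"
      using cInf_lessD[OF ne] e unfolding sq_circumradius_def by (metis less_add_same_cancel1)
    then show ?thesis
      unfolding sq_radius_bounds_def by (smt (verit) mem_Collect_eq)
  qed
  define e :: "nat \<Rightarrow> real" where "e n = inverse (real (Suc n))" for n
  have e_pos: "e n > 0" for n
    by (simp add: e_def)
  have e_lim: "e \<longlonglongrightarrow> 0"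
    unfolding e_def by (rule LIMSEQ_inverse_real_of_nat)
  have e_mono: "e n \<le> e N" if "N \<le> n" for n N
    using that by (simp add: e_def)
  obtain s where s: "\<And>n. s n \<in> M" "\<And>n b. b \<in> B \<Longrightarrow> (d (s n) b)\<^sup>2 \<le> ?r + e n"
    using approx[OF e_pos] by metis
  have "MCauchy s"
    unfolding MCauchy_def
  proof (intro conjI allI impI)
    show "range s \<subseteq> M" using s(1) by blast
    fix \<epsilon> :: real assume \<epsilon>: "\<epsilon> > 0"
    then obtain N where N: "e N < \<epsilon>\<^sup>2 / 4"
      using order_tendstoD(2)[OF e_lim, of "\<epsilon>\<^sup>2 / 4"] by (auto simp: eventually_sequentially)
    have "d (s n) (s k) < \<epsilon>" if "N \<le> n" "N \<le> k" for n k
    proof -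
      have "(d (s n) (s k))\<^sup>2 \<le> 4 * ((?r + e N) - ?r)"
      proof (rule centers_close[OF med B(1) BM s(1) s(1)])
        fix b assume "b \<in> B"
        then show "(d (s n) b)\<^sup>2 \<le> ?r + e N" "(d (s k) b)\<^sup>2 \<le> ?r + e N"
          using s(2)[of b n] s(2)[of b k] e_mono that by (meson add_left_mono order_trans)+
      qed
      then have "(d (s n) (s k))\<^sup>2 < \<epsilon>\<^sup>2"
        using N by simp
      then show ?thesis
        using \<epsilon> by (simp add: power2_less_imp_less)
    qed
    then show "\<exists>N. \<forall>n n'. N \<le> n \<longrightarrow> N \<le> n' \<longrightarrow> d (s n) (s n') < \<epsilon>"
      by blast
  qed
  then obtain c where c: "limitin mtopology s c sequentially"
    using complete by (auto simp: mcomplete_def)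
  then have cM: "c \<in> M"
    by (rule limitin_mspace)
  have "(d c b)\<^sup>2 \<le> ?r" if b: "b \<in> B" for b
  proof -
    have "(\<lambda>n. d (s n) b) \<longlonglongrightarrow> d c b"
    proof (rule LIM_zero_cancel, rule Lim_null_comparison)
      have "\<bar>d (s n) b - d c b\<bar> \<le> d (s n) c" for n
        using mdist_reverse_triangle[of "s n" b c] s(1) cM b BM by (auto simp: commute)
      then show "\<forall>\<^sub>F n in sequentially. norm (d (s n) b - d c b) \<le> d (s n) c"
        by simp
      show "(\<lambda>n. d (s n) c) \<longlonglongrightarrow> 0"
        using c by (simp add: limitin_metric_dist_null)
    qed
    then have "(\<lambda>n. (d (s n) b)\<^sup>2) \<longlonglongrightarrow> (d c b)\<^sup>2"
      by (rule tendsto_power)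
    moreover have "(\<lambda>n. ?r + e n) \<longlonglongrightarrow> ?r + 0"
      by (intro tendsto_intros e_lim)
    ultimately show ?thesis
      using s(2)[OF b] LIMSEQ_le[of "\<lambda>n. (d (s n) b)\<^sup>2" "(d c b)\<^sup>2" "\<lambda>n. ?r + e n" "?r + 0"] by auto
  qed
  then show "\<exists>c. c \<in> M \<and> (\<forall>b\<in>B. (d c b)\<^sup>2 \<le> ?r)"
    using cM by blast
  fix c c' assume "c \<in> M \<and> (\<forall>b\<in>B. (d c b)\<^sup>2 \<le> ?r)" "c' \<in> M \<and> (\<forall>b\<in>B. (d c' b)\<^sup>2 \<le> ?r)"
  then have "(d c c')\<^sup>2 \<le> 4 * (?r - ?r)" "c \<in> M" "c' \<in> M"
    using centers_close[OF med B(1) BM] by blast+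
  then show "c = c'" by simp
qed

section \<open>Groups of isometries with a bounded orbit\<close>

lemma BijGroup_mult_apply:
  assumes "g \<in> Bij X" "h \<in> Bij X" "x \<in> X"
  shows "(g \<otimes>\<^bsub>BijGroup X\<^esub> h) x = g (h x)"
  using assms by (simp add: BijGroup_def compose_eq)

lemma subgroup_BijGroup_in_Bij:
  "subgroup K (BijGroup X) \<Longrightarrow> g \<in> K \<Longrightarrow> g \<in> Bij X"
  by (drule subgroup.subset) (auto simp: BijGroup_def)

lemma Bij_apply_in: "g \<in> Bij X \<Longrightarrow> x \<in> X \<Longrightarrow> g x \<in> X"
  using Bij_imp_funcset by blast

text \<open>The Bruhat-Tits fixed point theorem. Each \<open>g \<in> K\<close> permutes the orbit, so it carries the
  smallest ball containing the orbit to a ball of the same radius containing it.\<close>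

theorem GAG_if_bounded_orbit:
  assumes "Metric_space E d" "Metric_space.mcomplete E d" "median_inequality E d"
    and K: "subgroup K (BijGroup E)" "K \<subseteq> Isom E d"
    and x: "x \<in> E" and bounded: "Metric_space.mbounded E d ((\<lambda>k. k x) ` K)"
  shows "GAG E K"
proof -
  interpret Metric_space E d by fact
  interpret BG: group "BijGroup E" by (rule group_BijGroup)
  let ?B = "(\<lambda>k. k x) ` K"
  let ?P = "\<lambda>c. c \<in> E \<and> (\<forall>b\<in>?B. (d c b)\<^sup>2 \<le> sq_circumradius E d ?B)"
  have "?B \<noteq> {}"
    using subgroup.one_closed[OF K(1)] by blast
  then have ex1: "\<exists>!c. ?P c"
    using assms(2,3) bounded by (intro ex1_circumcenter)
  then obtain c where c: "?P c" by blast
  have "g c = c" if g: "g \<in> K" for g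
  proof -
    have gB: "g \<in> Bij E"
      using g K(1) by (rule subgroup_BijGroup_in_Bij[rotated])
    \<comment> \<open>Every orbit point is the image under \<open>g\<close> of an orbit point: \<open>k x = g (g\<^sup>-\<^sup>1 k x)\<close>.\<close>
    have "(d (g c) (k x))\<^sup>2 \<le> sq_circumradius E d ?B" if k: "k \<in> K" for k
    proof -
      let ?k' = "inv\<^bsub>BijGroup E\<^esub> g \<otimes>\<^bsub>BijGroup E\<^esub> k"
      have k': "?k' \<in> K"
        using g k K(1) by (simp add: subgroup.m_closed subgroup.m_inv_closed)
      have "k = g \<otimes>\<^bsub>BijGroup E\<^esub> ?k'"
        using subgroup.mem_carrier[OF K(1)] g k by (simp flip: BG.m_assoc)
      then have "k x = g (?k' x)"
        using BijGroup_mult_apply[OF gB subgroup_BijGroup_in_Bij[OF K(1) k'] x] by simp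
      moreover have "d (g c) (g (?k' x)) = d c (?k' x)"
        using g K(2) c x Bij_apply_in[OF subgroup_BijGroup_in_Bij[OF K(1) k'] x]
        by (auto simp: Isom_def)
      ultimately show ?thesis
        using c k' by auto
    qed
    then have "?P (g c)"
      using c Bij_apply_in[OF gB] by blast
    then show ?thesis
      using ex1 c by blast
  qed
  then show ?thesis
    using c by (auto simp: GAG_def Fix_def)
qed

section \<open>Subgroups of finite index\<close>

text \<open>The orbit is no larger than the set of right cosets, because the coset \<open>H k\<^sup>-\<^sup>1\<close> determines
  \<open>k x\<close>: if \<open>H k\<^sup>-\<^sup>1 = H l\<^sup>-\<^sup>1\<close>, then \<open>k\<^sup>-\<^sup>1 l\<close> lies in \<open>K \<inter> H\<close> and fixes \<open>x\<close>. The inverses are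
  essential; \<open>k x\<close> is constant on the left cosets of the stabiliser of \<open>x\<close>, but
  in general not on the right ones.\<close>

lemma finite_orbit:
  assumes K: "subgroup K (BijGroup X)" and H: "subgroup H (BijGroup X)" and x: "x \<in> X"
    and fixed: "\<And>h. h \<in> K \<inter> H \<Longrightarrow> h x = x"
    and fin: "finite ((\<lambda>k. H #>\<^bsub>BijGroup X\<^esub> k) ` K)"
  shows "finite ((\<lambda>k. k x) ` K)"
proof -
  interpret BG: group "BijGroup X" by (rule group_BijGroup)
  note in_carrier = subgroup.mem_carrier[OF K]
  have eq: "k x = l x"
    if kl: "k \<in> K" "l \<in> K" 
      and coset: "H #>\<^bsub>BijGroup X\<^esub> (inv\<^bsub>BijGroup X\<^esub> k) = H #>\<^bsub>BijGroup X\<^esub> (inv\<^bsub>BijGroup X\<^esub> l)" for k l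
  proof -
    let ?h = "inv\<^bsub>BijGroup X\<^esub> k \<otimes>\<^bsub>BijGroup X\<^esub> l"
    have hK: "?h \<in> K"
      using kl K by (simp add: subgroup.m_closed subgroup.m_inv_closed)
    have "inv\<^bsub>BijGroup X\<^esub> k \<in> H #>\<^bsub>BijGroup X\<^esub> (inv\<^bsub>BijGroup X\<^esub> l)"
      using BG.rcos_self[OF _ H, of "inv\<^bsub>BijGroup X\<^esub> k"] in_carrier kl coset by simp
    then obtain h where h: "h \<in> H" "inv\<^bsub>BijGroup X\<^esub> k = h \<otimes>\<^bsub>BijGroup X\<^esub> inv\<^bsub>BijGroup X\<^esub> l"
      by (auto simp: r_coset_def)
    then have "?h = h"
      using in_carrier kl subgroup.mem_carrier[OF H] by (simp add: BG.m_assoc)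
    then have "?h x = x"
      using hK h(1) fixed by simp
    moreover have "l = k \<otimes>\<^bsub>BijGroup X\<^esub> ?h"
      using in_carrier kl by (simp flip: BG.m_assoc)
    then have "l x = k (?h x)"
      using BijGroup_mult_apply[OF subgroup_BijGroup_in_Bij[OF K kl(1)] subgroup_BijGroup_in_Bij[OF K hK] x]
      by simp
    ultimately show ?thesis by simp
  qed
  let ?q = "\<lambda>k. H #>\<^bsub>BijGroup X\<^esub> (inv\<^bsub>BijGroup X\<^esub> k)"
  have "?q ` K \<subseteq> (\<lambda>k. H #>\<^bsub>BijGroup X\<^esub> k) ` K"
    using subgroup.m_inv_closed[OF K] by blast
  then have "finite (?q ` K)"
    using fin finite_subset by blast
  moreover have "(\<lambda>k. k x) ` K \<subseteq> (\<lambda>Q. (SOME k. k \<in> K \<and> ?q k = Q) x) ` ?q ` K"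
  proof
    fix y assume "y \<in> (\<lambda>k. k x) ` K"
    then obtain k where k: "k \<in> K" "y = k x" by blast
    define l where "l = (SOME l. l \<in> K \<and> ?q l = ?q k)"
    have l: "l \<in> K \<and> ?q l = ?q k"
      unfolding l_def by (rule someI[of _ k]) (simp add: k)
    then have "y = l x"
      using eq[of k l] k by simp
    then show "y \<in> (\<lambda>Q. (SOME k. k \<in> K \<and> ?q k = Q) x) ` ?q ` K"
      using k(1) unfolding l_def by blast
  qed
  ultimately show ?thesis
    by (meson finite_imageI finite_subset)
qed

theorem fixating_if_finite_index:
  assumes met: "Metric_space E d" "Metric_space.mcomplete E d" "median_inequality E d"
    and G: "subgroup G (IsomGroup E d)" and H: "subgroup H (IsomGroup E d \<lparr>carrier := G\<rparr>)"
    and fin: "finite (rcosets\<^bsub>IsomGroup E d \<lparr>carrier := G\<rparr>\<^esub> H)"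
    and fix_H: "fixating E H"
  shows "fixating E G"
  unfolding fixating_def
proof (intro allI impI)
  fix K assume K: "subgroup K (BijGroup E \<lparr>carrier := G\<rparr>)" and GAF: "GAF E K"
  interpret Metric_space E d by fact
  interpret BG: group "BijGroup E" by (rule group_BijGroup)
  have G': "subgroup G (BijGroup E)"
    using BG.incl_subgroup[OF subgroup_Isom] G unfolding IsomGroup_def by blast
  have K': "subgroup K (BijGroup E)"
    by (rule BG.incl_subgroup[OF G' K])
  have H': "subgroup H (BijGroup E)"
    using BG.incl_subgroup[OF G'] H by (simp add: IsomGroup_def)
  have KG: "K \<subseteq> G"
    using subgroup.subset[OF K] by simp
  have GI: "G \<subseteq> Isom E d"
    using subgroup.subset[OF G] by (simp add: IsomGroup_def)
  have "subgroup (K \<inter> H) (BijGroup E \<lparr>carrier := H\<rparr>)"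
    by (rule BG.subgroup_incl[OF BG.subgroups_Inter_pair[OF K' H'] H']) simp
  moreover have "GAF E (K \<inter> H)"
    using GAF by (simp add: GAF_def)
  ultimately have "GAG E (K \<inter> H)"
    using fix_H by (simp add: fixating_def)
  then obtain x where x: "\<And>h. h \<in> K \<inter> H \<Longrightarrow> h x = x" "\<And>h. h \<in> K \<inter> H \<Longrightarrow> x \<in> E"
    by (auto simp: GAG_def Fix_def)
  have xE: "x \<in> E"
    using x(2) subgroup.one_closed[OF K'] subgroup.one_closed[OF H'] by blast
  have "(\<lambda>k. H #>\<^bsub>BijGroup E\<^esub> k) ` K \<subseteq> rcosets\<^bsub>IsomGroup E d \<lparr>carrier := G\<rparr>\<^esub> H"
    using KG by (auto simp: RCOSETS_def r_coset_def IsomGroup_def)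
  then have "finite ((\<lambda>k. k x) ` K)"
    using finite_orbit[OF K' H' xE] x(1) fin finite_subset by blast
  moreover have "(\<lambda>k. k x) ` K \<subseteq> E"
    using Bij_apply_in[OF subgroup_BijGroup_in_Bij[OF K'] xE] by blast
  ultimately have "Metric_space.mbounded E d ((\<lambda>k. k x) ` K)"
    using compactin_imp_mbounded by (simp add: finite_imp_compactin)
  then show "GAG E K"
    using GAG_if_bounded_orbit[OF met K' _ xE] KG GI by blast
qed

theorem corollary4p8:
  fixes E :: "'a set" and d :: "'a \<Rightarrow> 'a \<Rightarrow> real"
  assumes "Metric_space E d"
    and "Metric_space.mcomplete E d"
    and "median_inequality E d"
  shows
    "(\<forall>G H. subgroup G (IsomGroup E d) \<longrightarrow>
        H \<lhd> (IsomGroup E d \<lparr>carrier := G\<rparr>) \<longrightarrow>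
        solvable ((IsomGroup E d \<lparr>carrier := G\<rparr>) Mod H) \<longrightarrow>
        finite (carrier ((IsomGroup E d \<lparr>carrier := G\<rparr>) Mod H)) \<longrightarrow>
        fixating E H \<longrightarrow> fixating E G)
     \<and>
     (\<forall>G H. subgroup G (IsomGroup E d) \<longrightarrow>
        subgroup H (IsomGroup E d \<lparr>carrier := G\<rparr>) \<longrightarrow>
        card (rcosets\<^bsub>IsomGroup E d \<lparr>carrier := G\<rparr>\<^esub> H) = 2 \<longrightarrow>
        fixating E H \<longrightarrow> fixating E G)"
proof (intro conjI allI impI)
  fix G H
  assume "subgroup G (IsomGroup E d)" "H \<lhd> (IsomGroup E d \<lparr>carrier := G\<rparr>)"
    "finite (carrier ((IsomGroup E d \<lparr>carrier := G\<rparr>) Mod H))" "fixating E H"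
  then show "fixating E G"
    by (intro fixating_if_finite_index[OF assms, of G H])
      (simp_all add: FactGroup_def normal_imp_subgroup)
next
  fix G H
  assume "subgroup G (IsomGroup E d)" "subgroup H (IsomGroup E d \<lparr>carrier := G\<rparr>)"
    "card (rcosets\<^bsub>IsomGroup E d \<lparr>carrier := G\<rparr>\<^esub> H) = 2" "fixating E H"
  then show "fixating E G"
    by (intro fixating_if_finite_index[OF assms, of G H]) (simp_all add: card_ge_0_finite)
qed

end
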